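(* Let $g\in L^2(\mathbb R)$ and $a,b>0$. The following are equivalent: (1) $(g,a)$ is a $1/b$-frame. (2) $(g,a,b)$ is a Weyl-Heisenberg frame for $L^2(\mathbb R)$.
   Context: $T_cf(x)=f(x-c)$, $E_cf(x)=e^{2\pi icx}f(x)$. $(g,a)$ denotes the family $(T_{na}g)_{n\in\mathbb Z}$, and $(g,a,b)$ the family $(E_{mb}T_{na}g)_{m,n\in\mathbb Z}$. The latter is a Weyl-Heisenberg frame if there are $A,B>0$ with $A\|f\|^2\le\sum_{m,n}|\langle f,E_{mb}T_{na}g\rangle|^2\le B\|f\|^2$ for all $f\in L^2(\mathbb R)$. For $c>0$ and $f,h\in L^2(\mathbb R)$, $\langle f,h\rangle_c(t)=\sum_{n\in\mathbb Z}f(t-nc)\overline{h(t-nc)}$ (a $c$-periodic function, defined a.e.) and $\|f\|_c(t)=\sqrt{\langle f,f\rangle_c(t)}$. A sequence $(g_n)_{n\in\mathbb Z}$ in $L^2(\mathbb R)$ is a $c$-frame if there are constants $A,B>0$ such that $A\|f\|_c^2\le\sum_{n\in\mathbb Z}|\langle f,g_n\rangle_c|^2\le B\|f\|_c^2$ (a.e., as functions) for all $f\in L^2(\mathbb R)$. *)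

theory Defs
  imports "HOL-Analysis.Analysis"
begin

text \<open>
  Elements of \<open>L\<^sup>2(\<real>)\<close> are represented by Lebesgue measurable functions rather than by
  almost-everywhere classes.
\<close>

definition L2 :: "(real \<Rightarrow> complex) set" where
  "L2 = {f. f \<in> borel_measurable lebesgue \<and> integrable lebesgue (\<lambda>x. (norm (f x))\<^sup>2)}"

definition L2_inner :: "(real \<Rightarrow> complex) \<Rightarrow> (real \<Rightarrow> complex) \<Rightarrow> complex" where
  "L2_inner f h = (LINT x|lebesgue. f x * cnj (h x))"

definition L2_norm :: "(real \<Rightarrow> complex) \<Rightarrow> real" where
  "L2_norm f = sqrt (LINT x|lebesgue. (norm (f x))\<^sup>2)"

definition translation :: "real \<Rightarrow> (real \<Rightarrow> complex) \<Rightarrow> real \<Rightarrow> complex" where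
  "translation c f = (\<lambda>x. f (x - c))"

definition modulation :: "real \<Rightarrow> (real \<Rightarrow> complex) \<Rightarrow> real \<Rightarrow> complex" where
  "modulation c f = (\<lambda>x. exp (2 * complex_of_real pi * \<i> * complex_of_real c * complex_of_real x) * f x)"

text \<open>
  For \<open>c > 0\<close> and \<open>f\<close>, \<open>h\<close> in \<open>L2\<close> the series below converges absolutely for almost every \<open>t\<close>;
  on the exceptional null set \<open>infsum\<close> takes the irrelevant default value \<open>0\<close>.
\<close>

definition bracket :: "real \<Rightarrow> (real \<Rightarrow> complex) \<Rightarrow> (real \<Rightarrow> complex) \<Rightarrow> real \<Rightarrow> complex" where
  "bracket c f h t =
     (\<Sum>\<^sub>\<infinity>n::int. f (t - of_int n * c) * cnj (h (t - of_int n * c)))"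

text \<open>\<open>bracket c f f t\<close> is a nonnegative real, so \<open>Re\<close> is only a type coercion here.\<close>

definition bracket_norm :: "real \<Rightarrow> (real \<Rightarrow> complex) \<Rightarrow> real \<Rightarrow> real" where
  "bracket_norm c f t = sqrt (Re (bracket c f f t))"

text \<open>
  The sums in the two frame conditions are taken in \<open>ennreal\<close>, where a divergent sum is \<open>\<infinity>\<close>.
  Hence the upper bounds include the convergence of these sums; a real-valued \<open>infsum\<close> would make
  a divergent sum equal to \<open>0\<close>.
\<close>

definition c_frame :: "real \<Rightarrow> (int \<Rightarrow> real \<Rightarrow> complex) \<Rightarrow> bool" where
  "c_frame c gs \<longleftrightarrow>
     (\<forall>n. gs n \<in> L2) \<and>
     (\<exists>A B :: real. A > 0 \<and> B > 0 \<and>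
        (\<forall>f\<in>L2. AE t in lebesgue.
           ennreal (A * (bracket_norm c f t)\<^sup>2)
             \<le> (\<Sum>\<^sub>\<infinity>n::int. ennreal ((norm (bracket c f (gs n) t))\<^sup>2)) \<and>
           (\<Sum>\<^sub>\<infinity>n::int. ennreal ((norm (bracket c f (gs n) t))\<^sup>2))
             \<le> ennreal (B * (bracket_norm c f t)\<^sup>2)))"

definition translates :: "(real \<Rightarrow> complex) \<Rightarrow> real \<Rightarrow> int \<Rightarrow> real \<Rightarrow> complex" where
  "translates g a n = translation (of_int n * a) g"

definition WH_family :: "(real \<Rightarrow> complex) \<Rightarrow> real \<Rightarrow> real \<Rightarrow> int \<times> int \<Rightarrow> real \<Rightarrow> complex" where
  "WH_family g a b = (\<lambda>(m, n). modulation (of_int m * b) (translation (of_int n * a) g))"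

definition WH_frame :: "(real \<Rightarrow> complex) \<Rightarrow> real \<Rightarrow> real \<Rightarrow> bool" where
  "WH_frame g a b \<longleftrightarrow>
     (\<exists>A B :: real. A > 0 \<and> B > 0 \<and>
        (\<forall>f\<in>L2.
           ennreal (A * (L2_norm f)\<^sup>2)
             \<le> (\<Sum>\<^sub>\<infinity>k::int \<times> int. ennreal ((norm (L2_inner f (WH_family g a b k)))\<^sup>2)) \<and>
           (\<Sum>\<^sub>\<infinity>k::int \<times> int. ennreal ((norm (L2_inner f (WH_family g a b k)))\<^sup>2))
             \<le> ennreal (B * (L2_norm f)\<^sup>2)))"

end

theory Submission
  imports Defs
begin

text \<open>
  The inner product of \<open>f\<close> with \<open>E\<^bsub>mb\<^esub> T\<^bsub>na\<^esub> g\<close> is the \<open>m\<close>-th Fourier coefficient, on one period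
  \<open>[0, 1/b)\<close>, of the bracket of \<open>f\<close> with \<open>T\<^bsub>na\<^esub> g\<close>. By Parseval's identity the Weyl-Heisenberg sum of
  \<open>f\<close> is therefore \<open>1/b\<close> times the integral over one period of the sum in the \<open>1/b\<close>-frame condition,
  while the integral of the squared bracket norm is the squared \<open>L\<^sup>2\<close> norm of \<open>f\<close>. Integrating the
  pointwise inequalities gives one implication. Conversely, cutting \<open>f\<close> off to a \<open>1/b\<close>-periodic set \<open>E\<close>
  cuts both integrals off to \<open>E\<close>; taking for \<open>E\<close> the set where a pointwise inequality
  fails shows that \<open>E\<close> is null.

  Brackets are a priori only integrable, so Parseval's identity is needed for integrable functions, with
  both sides in \<open>[0, \<infinity>]\<close>.
\<close>

subsection \<open>Trigonometric polynomials\<close>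

definition char :: "real \<Rightarrow> int \<Rightarrow> real \<Rightarrow> complex" where
  "char b m t = cis (2 * pi * of_int m * b * t)"

lemma modulation_eq_char: "modulation (of_int m * b) f = (\<lambda>x. char b m x * f x)"
  by (simp add: modulation_def char_def cis_conv_exp algebra_simps)

lemma norm_char [simp]: "norm (char b m t) = 1"
  by (simp add: char_def)

lemma cnj_char: "cnj (char b m t) = char b (- m) t"
  by (simp add: char_def cis_cnj)

lemma char_mult: "char b m t * char b n t = char b (m + n) t"
  by (simp add: char_def cis_mult algebra_simps)

lemma char_0 [simp]: "char b 0 t = 1"
  by (simp add: char_def)

lemma char_periodic:
  assumes "b \<noteq> 0"
  shows "char b m (t - of_int n * (1 / b)) = char b m t"
proof -
  have "2 * pi * of_int m * b * (t - of_int n * (1 / b)) =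
      2 * pi * of_int m * b * t + 2 * pi * of_int (- (m * n))"
    using assms by (simp add: field_simps)
  then have "char b m (t - of_int n * (1 / b)) = char b m t * cis (2 * pi * of_int (- (m * n)))"
    by (simp only: char_def cis_mult)
  then show ?thesis
    by (simp only: cis_multiple_2pi[OF Ints_of_int] mult_1_right)
qed

lemma continuous_on_char [continuous_intros]: "continuous_on S (char b m)"
  unfolding char_def by (intro continuous_intros)

lemma measurable_char [measurable]: "char b m \<in> borel_measurable (lebesgue_on S)"
  using continuous_on_char[of UNIV b m]
  by (simp add: borel_measurable_continuous_onI measurable_completion measurable_restrict_space1)

abbreviation period_space :: "real \<Rightarrow> real measure" where
  "period_space b \<equiv> lebesgue_on {0..<1 / b}"

lemma finite_measure_period_space: "finite_measure (period_space b)"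
  using emeasure_bounded_finite[of "{0..<1 / b}"]
  by (intro finite_measureI) (simp add: emeasure_restrict_space)

lemma integrable_char: "integrable (period_space b) (char b m)"
  by (rule finite_measure.integrable_const_bound[OF finite_measure_period_space, where B = 1]) simp_all

lemma integral_char:
  assumes "b > 0"
  shows "(LINT t|period_space b. char b m t) = (if m = 0 then of_real (1 / b) else 0)"
proof (cases "m = 0")
  case True
  have "measure (period_space b) {0..<1 / b} = 1 / b"
    using assms by (simp add: measure_restrict_space)
  with True show ?thesis
    by (simp add: scaleR_conv_of_real)
next
  case False
  define w where "w = 2 * pi * of_int m * b"
  have w: "w \<noteq> 0"
    using False assms by (simp add: w_def)
  have der: "((\<lambda>t. cis (w * t) / (\<i> * w)) has_vector_derivative char b m t) (at t within {0..1 / b})" for t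
  proof -
    have "((\<lambda>z. exp (\<i> * w * z) / (\<i> * w)) has_field_derivative exp (\<i> * w * of_real t)) (at (of_real t))"
      using w by (auto intro!: derivative_eq_intros)
    from has_vector_derivative_real_field[OF this, of "{0..1 / b}"] show ?thesis
      by (simp add: char_def w_def cis_conv_exp mult_ac)
  qed
  have "(char b m has_integral (cis (w * (1 / b)) / (\<i> * w) - cis (w * 0) / (\<i> * w))) {0..1 / b}"
    using assms der by (intro fundamental_theorem_of_calculus) auto
  moreover have "cis (w * (1 / b)) = 1"
    using assms cis_multiple_2pi[of "of_int m"] by (simp add: w_def)
  ultimately have "(char b m has_integral 0) {0..1 / b}"
    by simp
  \<comment> \<open>The fundamental theorem of calculus is applied on the closed interval; the
    half-open period differs from it only by the endpoint \<open>1 / b\<close>, a negligible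
    set.\<close>
  moreover have "(char b m has_integral 0) {0..1 / b} \<longleftrightarrow> (char b m has_integral 0) {0..<1 / b}"
    by (rule has_integral_spike_set_eq) (rule negligible_subset[of "{1 / b}"], auto)+
  ultimately have "(char b m has_integral 0) {0..<1 / b}"
    by simp
  then show ?thesis
    using False integrable_char has_integral_integral_lebesgue_on[of "{0..<1 / b}" "char b m"]
    by (auto dest: has_integral_unique)
qed

text \<open>An inductive form makes closure under sums immediate and closure under products a nested
  induction; explicit coefficients are recovered in \<open>trig_poly_expansion\<close>.\<close>

inductive trig_poly :: "real \<Rightarrow> (real \<Rightarrow> complex) \<Rightarrow> bool" for b where
  char: "trig_poly b (\<lambda>t. \<alpha> * char b m t)"
| add: "trig_poly b p \<Longrightarrow> trig_poly b q \<Longrightarrow> trig_poly b (\<lambda>t. p t + q t)"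

lemma trig_poly_const: "trig_poly b (\<lambda>t. \<alpha>)"
  using trig_poly.char[of b \<alpha> 0] by simp

lemma trig_poly_mult:
  assumes "trig_poly b p" "trig_poly b q"
  shows "trig_poly b (\<lambda>t. p t * q t)"
  using assms
proof (induction p)
  case (char \<alpha> m)
  from \<open>trig_poly b q\<close> show ?case
  proof induction
    case (char \<beta> n)
    have "(\<lambda>t. \<alpha> * char b m t * (\<beta> * char b n t)) = (\<lambda>t. (\<alpha> * \<beta>) * char b (m + n) t)"
      by (simp add: char_mult[symmetric] mult_ac)
    then show ?case
      by (simp only: trig_poly.char)
  qed (simp add: ring_distribs trig_poly.add)
qed (simp add: ring_distribs trig_poly.add)

lemma trig_poly_expansion:
  assumes "trig_poly b p"
  obtains S \<alpha> where "finite S" "p = (\<lambda>t. \<Sum>m\<in>S. \<alpha> m * char b m t)"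
proof -
  from assms have "\<exists>S \<alpha>. finite S \<and> p = (\<lambda>t. \<Sum>m\<in>S. \<alpha> m * char b m t)"
  proof induction
    case (char \<alpha> m)
    show ?case
      by (intro exI[of _ "{m}"] exI[of _ "\<lambda>_. \<alpha>"]) simp
  next
    case (add p q)
    then obtain S \<alpha> T \<beta> where S: "finite S" "p = (\<lambda>t. \<Sum>m\<in>S. \<alpha> m * char b m t)"
      and T: "finite T" "q = (\<lambda>t. \<Sum>m\<in>T. \<beta> m * char b m t)"
      by blast
    \<comment> \<open>Both coefficient families are extended by 0 to \<open>S \<union> T\<close>; at
      common frequencies they add up.\<close>
    define \<gamma> where "\<gamma> m = (if m \<in> S then \<alpha> m else 0) + (if m \<in> T then \<beta> m else 0)" for m
    have "p t = (\<Sum>m\<in>S \<union> T. (if m \<in> S then \<alpha> m else 0) * char b m t)" for t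
      unfolding S by (rule sum.mono_neutral_cong_left) (use S T in auto)
    moreover have "q t = (\<Sum>m\<in>S \<union> T. (if m \<in> T then \<beta> m else 0) * char b m t)" for t
      unfolding T by (rule sum.mono_neutral_cong_left) (use S T in auto)
    ultimately have "(\<lambda>t. p t + q t) = (\<lambda>t. \<Sum>m\<in>S \<union> T. \<gamma> m * char b m t)"
      by (simp add: \<gamma>_def ring_distribs sum.distrib)
    with S T show ?case
      by blast
  qed
  then show thesis
    using that by blast
qed

text \<open>A real-linear functional on the complex plane is a combination of \<open>z\<close> and
  \<open>cnj z\<close>, and at \<open>z = char b 1 t\<close> the conjugate is the character of
  frequency \<open>- 1\<close>. Constants, sums and products stay among trigonometric
  polynomials.\<close>

lemma trig_poly_real_polynomial:
  assumes "real_polynomial_function h"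
  shows "trig_poly b (\<lambda>t. of_real (h (char b 1 t)))"
  using assms
proof induction
  case (linear h)
  have "of_real (h z) = (h 1 - \<i> * h \<i>) / 2 * z + (h 1 + \<i> * h \<i>) / 2 * cnj z" for z :: complex
  proof -
    interpret bounded_linear h by fact
    have "h z = h (Re z *\<^sub>R 1 + Im z *\<^sub>R \<i>)"
      by (simp add: scaleR_conv_of_real complex_eq[symmetric] mult.commute)
    also have "\<dots> = Re z * h 1 + Im z * h \<i>"
      by (simp only: add scaleR real_scaleR_def)
    finally show ?thesis
      by (simp add: complex_eq_iff algebra_simps add_divide_distrib diff_divide_distrib)
  qed
  then have "(\<lambda>t. of_real (h (char b 1 t))) =
      (\<lambda>t. (h 1 - \<i> * h \<i>) / 2 * char b 1 t + (h 1 + \<i> * h \<i>) / 2 * char b (- 1) t)"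
    by (metis cnj_char)
  then show ?case
    by (simp only: trig_poly.intros)
qed (simp_all add: trig_poly_const trig_poly.add trig_poly_mult)

lemma trig_poly_polynomial:
  assumes "polynomial_function (h :: complex \<Rightarrow> complex)"
  shows "trig_poly b (\<lambda>t. h (char b 1 t))"
proof -
  have "real_polynomial_function (Re \<circ> h)" "real_polynomial_function (Im \<circ> h)"
    using assms by (simp_all add: polynomial_function_def bounded_linear_Re bounded_linear_Im)
  from this[THEN trig_poly_real_polynomial, of b]
  have "trig_poly b (\<lambda>t. of_real (Re (h (char b 1 t))) + \<i> * of_real (Im (h (char b 1 t))))"
    by (intro trig_poly.add trig_poly_mult trig_poly_const) simp_all
  then show ?thesis
    by (simp add: complex_eq[symmetric])
qed

section \<open>Approximation by trigonometric polynomials, via Stone-Weierstrass on the unit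
  circle\<close>

lemma trig_poly_dense:
  fixes \<phi> :: "real \<Rightarrow> complex"
  assumes b: "b > 0" and cont: "continuous_on {0..1 / b} \<phi>" and ends: "\<phi> 0 = \<phi> (1 / b)" and "e > 0"
  obtains p where "trig_poly b p" "\<And>t. t \<in> {0..1 / b} \<Longrightarrow> norm (\<phi> t - p t) < e"
proof -
  let ?I = "{0..1 / b}" and ?C = "char b 1 ` {0..1 / b}"
  \<comment> \<open>The map \<open>char b 1\<close> wraps the closed period around the circle and
    identifies only its two endpoints, where \<open>\<phi>\<close> takes the same value. So
    \<open>\<phi>\<close> depends on \<open>t\<close> only through
    \<open>char b 1 t\<close>.\<close>
  have factor: "\<phi> s = \<phi> t" if st: "s \<in> ?I" "t \<in> ?I" "char b 1 s = char b 1 t" for s t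
  proof -
    obtain n :: int where "2 * pi * b * s = 2 * pi * b * t + 2 * pi * of_int n"
      using st(3) sin_cos_eq_iff[of "2 * pi * b * s" "2 * pi * b * t"]
      by (auto simp: char_def complex_eq_iff)
    then have "2 * pi * (b * s) = 2 * pi * (b * t + of_int n)"
      by (simp add: algebra_simps)
    then have n: "b * s = b * t + of_int n"
      by simp
    have "0 \<le> b * s" "b * s \<le> 1" "0 \<le> b * t" "b * t \<le> 1"
      using that b by (auto simp: field_simps)
    with n consider "b * s = b * t" | "b * s = 0" "b * t = 1" | "b * s = 1" "b * t = 0"
      by (cases "n = 0"; cases "n = 1"; cases "n = -1"; simp)
    then consider "s = t" | "s = 0" "t = 1 / b" | "s = 1 / b" "t = 0"
      using b by (auto simp: field_simps)
    then show ?thesis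
      using ends by cases auto
  qed
  \<comment> \<open>The function that \<open>\<phi>\<close> induces on the circle; by
    \<open>factor\<close> the chosen preimage does not matter.\<close>
  define \<psi> where "\<psi> z = \<phi> (SOME t. t \<in> ?I \<and> char b 1 t = z)" for z
  have \<psi>: "\<psi> (char b 1 t) = \<phi> t" if "t \<in> ?I" for t
  proof -
    have "(SOME s. s \<in> ?I \<and> char b 1 s = char b 1 t) \<in> ?I \<and>
        char b 1 (SOME s. s \<in> ?I \<and> char b 1 s = char b 1 t) = char b 1 t"
      by (rule someI[of "\<lambda>s. s \<in> ?I \<and> char b 1 s = char b 1 t" t]) (use that in simp)
    then show ?thesis
      unfolding \<psi>_def using that factor by blast
  qed
  \<comment> \<open>The graph of \<open>\<psi>\<close> is the continuous image of the compact
    period, hence closed, and the values of \<open>\<psi>\<close> lie in a compact set; a closed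
    graph then gives continuity.\<close>
  have "continuous_on ?C \<psi>"
  proof (rule continuous_from_closed_graph)
    show "compact (\<phi> ` ?I)"
      using cont by (intro compact_continuous_image) auto
    show "\<psi> \<in> ?C \<rightarrow> \<phi> ` ?I"
      using \<psi> by auto
    have "(\<lambda>z. (z, \<psi> z)) ` ?C = (\<lambda>t. (char b 1 t, \<phi> t)) ` ?I"
      using \<psi> by (auto simp: image_image)
    moreover have "compact ((\<lambda>t. (char b 1 t, \<phi> t)) ` ?I)"
      using cont by (intro compact_continuous_image continuous_intros) auto
    ultimately show "closed ((\<lambda>z. (z, \<psi> z)) ` ?C)"
      by (simp add: compact_imp_closed)
  qed
  moreover have "compact ?C"
    by (intro compact_continuous_image continuous_intros) auto
  ultimately obtain h where h: "polynomial_function h" "\<And>z. z \<in> ?C \<Longrightarrow> norm (\<psi> z - h z) < e"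
    using Stone_Weierstrass_polynomial_function[of ?C \<psi> e] \<open>e > 0\<close> by blast
  show thesis
    by (rule that[OF trig_poly_polynomial[OF h(1)]]) (use h(2) \<psi> in force)
qed

lemma measurable_cnj [measurable (raw)]:
  "f \<in> borel_measurable M \<Longrightarrow> (\<lambda>x. cnj (f x)) \<in> borel_measurable M"
  by (rule measurable_compose[of f M borel cnj borel]) (auto intro!: borel_measurable_continuous_onI continuous_intros)

text \<open>A measurable function is an a.e. limit of continuous ones. These are clipped to the ball
  of radius \<open>K\<close>, damped to 0 at both endpoints so that they become periodic, and then
  approximated uniformly. The bound \<open>K + 1\<close>, common to all \<open>n\<close>, serves
  dominated convergence later.\<close>

lemma trig_poly_bounded_approx:
  fixes \<phi> :: "real \<Rightarrow> complex"
  assumes b: "b > 0" and meas: "\<phi> \<in> borel_measurable (period_space b)"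
    and bound: "\<And>t. t \<in> {0..<1 / b} \<Longrightarrow> norm (\<phi> t) \<le> K"
  obtains p where "\<And>n::nat. trig_poly b (p n)"
    and "\<And>n t. t \<in> {0..<1 / b} \<Longrightarrow> norm (p n t) \<le> K + 1"
    and "AE t in period_space b. (\<lambda>n. p n t) \<longlonglongrightarrow> \<phi> t"
proof -
  have "norm (\<phi> 0) \<le> K"
    using b bound[of 0] by simp
  then have K: "K \<ge> 0"
    using norm_ge_zero order_trans by blast
  have "\<phi> measurable_on {0..<1 / b}"
    using meas by (subst measurable_on_iff_borel_measurable) auto
  then obtain N g where N: "negligible N" and g: "\<And>n::nat. continuous_on UNIV (g n)"
    and lim: "\<And>t. t \<notin> N \<Longrightarrow> (\<lambda>n. g n t) \<longlonglongrightarrow> (if t \<in> {0..<1 / b} then \<phi> t else 0)"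
    unfolding measurable_on_def by blast
  \<comment> \<open>Nearest-point projection onto the ball: continuous, bounded by \<open>K\<close>,
    and the identity on the values of \<open>\<phi>\<close> in the period.\<close>
  define P where "P = closest_point (cball (0::complex) K)"
  have P_cont: "continuous_on S P" for S
    unfolding P_def using K by (intro continuous_on_closest_point) auto
  have P_bound: "norm (P z) \<le> K" for z
    using closest_point_in_set[of "cball (0::complex) K" z] K by (simp add: P_def)
  have P_id: "P z = z" if "norm z \<le> K" for z
    using that by (simp add: P_def closest_point_self)
  \<comment> \<open>A continuous cutoff that vanishes at 0 and \<open>1 / b\<close> and, at each
    interior point, equals 1 for all large \<open>n\<close>.\<close>
  define \<tau> where "\<tau> n t = min 1 (real n * (t * (1 / b - t)))" for n t
  define q where "q n t = of_real (\<tau> n t) * P (g n t)" for n t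
  have q_bound: "norm (q n t) \<le> K" if "t \<in> {0..1 / b}" for n t
  proof -
    have "0 \<le> \<tau> n t" "\<tau> n t \<le> 1"
      using that by (auto simp: \<tau>_def)
    then have "norm (q n t) \<le> 1 * K"
      unfolding q_def norm_mult by (intro mult_mono P_bound) auto
    then show ?thesis
      by simp
  qed
  \<comment> \<open>The error bound tends to 0, which preserves the limit, and never exceeds 1,
    which accounts for the bound \<open>K + 1\<close>.\<close>
  have "\<exists>p. trig_poly b p \<and> (\<forall>t\<in>{0..1 / b}. norm (q n t - p t) < inverse (real (Suc n)))" for n
  proof (rule trig_poly_dense[OF b, of "q n" "inverse (real (Suc n))"])
    show "continuous_on {0..1 / b} (q n)"
      unfolding q_def \<tau>_def
      by (intro continuous_intros continuous_on_compose2[OF P_cont[of UNIV]] continuous_on_subset[OF g]) auto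
  qed (auto simp: q_def \<tau>_def)
  then obtain p where p: "\<And>n. trig_poly b (p n)"
    and close: "\<And>n t. t \<in> {0..1 / b} \<Longrightarrow> norm (q n t - p n t) < inverse (real (Suc n))"
    by metis
  show thesis
  proof (rule that[of p])
    show "trig_poly b (p n)" for n
      by (rule p)
    show "norm (p n t) \<le> K + 1" if "t \<in> {0..<1 / b}" for n t
    proof -
      have "norm (p n t) \<le> norm (q n t) + norm (q n t - p n t)"
        using norm_triangle_ineq4[of "q n t" "q n t - p n t"] by simp
      also have "\<dots> \<le> K + 1"
      proof (intro add_mono q_bound)
        have "inverse (real (Suc n)) \<le> 1"
          by (simp add: inverse_eq_divide)
        then show "norm (q n t - p n t) \<le> 1"
          using close[of t n] that by auto
      qed (use that in auto)
      finally show ?thesis .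
    qed
    \<comment> \<open>The point 0 belongs to the half-open period, but the cutoff is always 0 there;
      it is discarded together with \<open>N\<close>.\<close>
    have conv: "(\<lambda>n. p n t) \<longlonglongrightarrow> \<phi> t" if t: "t \<in> {0..<1 / b}" "t \<notin> insert 0 N" for t
    proof -
      have pos: "t * (1 / b - t) > 0"
        using t by auto
      obtain n0 where n0: "real n0 * (t * (1 / b - t)) > 1"
        using reals_Archimedean3[OF pos] by blast
      have "eventually (\<lambda>n. \<tau> n t = 1) sequentially"
        using eventually_ge_at_top[of n0]
      proof eventually_elim
        case (elim n)
        then have "real n0 * (t * (1 / b - t)) \<le> real n * (t * (1 / b - t))"
          using pos by (intro mult_right_mono) auto
        with n0 show ?case
          by (simp add: \<tau>_def)
      qed
      then have "(\<lambda>n. of_real (\<tau> n t)) \<longlonglongrightarrow> (1::complex)"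
        by (intro tendsto_eventually) (auto elim: eventually_mono)
      moreover have "(\<lambda>n. P (g n t)) \<longlonglongrightarrow> P (\<phi> t)"
        using lim[of t] t
        by (intro continuous_on_tendsto_compose[OF P_cont[of UNIV]]) auto
      ultimately have "(\<lambda>n. q n t) \<longlonglongrightarrow> 1 * P (\<phi> t)"
        unfolding q_def by (intro tendsto_mult)
      moreover have "(\<lambda>n. q n t - p n t) \<longlonglongrightarrow> 0"
        using t close by (intro Lim_null_comparison[OF _ LIMSEQ_inverse_real_of_nat] always_eventually)
          (auto intro: less_imp_le)
      ultimately have "(\<lambda>n. q n t - (q n t - p n t)) \<longlonglongrightarrow> 1 * P (\<phi> t) - 0"
        by (intro tendsto_diff)
      then show ?thesis
        using P_id[OF bound[of t]] t by simp
    qed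
    have "negligible (insert 0 N)"
      using N by simp
    then have "AE t in lebesgue. t \<notin> insert 0 N"
      by (intro AE_not_in) (simp add: negligible_iff_null_sets)
    then show "AE t in period_space b. (\<lambda>n. p n t) \<longlonglongrightarrow> \<phi> t"
      using conv by (subst AE_restrict_space_iff) (auto elim: eventually_mono)
  qed
qed

subsection \<open>Parseval's identity\<close>

text \<open>Unnormalised: the coefficients of the Fourier series are
  \<open>b * fourier_coeff b F m\<close>, and Parseval's identity carries the constant
  \<open>1 / b\<close>.\<close>

definition fourier_coeff :: "real \<Rightarrow> (real \<Rightarrow> complex) \<Rightarrow> int \<Rightarrow> complex" where
  "fourier_coeff b F m = (LINT t|period_space b. F t * char b (- m) t)"

lemma integrable_mult_char:
  assumes "integrable (period_space b) F"
  shows "integrable (period_space b) (\<lambda>t. F t * char b m t)"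
proof -
  have [measurable]: "F \<in> borel_measurable (period_space b)"
    using assms by simp
  show ?thesis
    by (rule Bochner_Integration.integrable_bound[OF assms]) (auto simp: norm_mult)
qed

text \<open>The square expands into a double sum over characters of frequency \<open>m - n\<close>,
  of which orthogonality leaves the diagonal.\<close>

lemma integral_norm_sum_char:
  assumes "b > 0" "finite S"
  shows "(LINT t|period_space b. (norm (\<Sum>m\<in>S. \<alpha> m * char b m t))\<^sup>2) = (\<Sum>m\<in>S. (norm (\<alpha> m))\<^sup>2) / b"
    and "integrable (period_space b) (\<lambda>t. (norm (\<Sum>m\<in>S. \<alpha> m * char b m t))\<^sup>2)"
proof -
  have expand: "of_real ((norm (\<Sum>m\<in>S. \<alpha> m * char b m t))\<^sup>2) =
      (\<Sum>m\<in>S. \<Sum>n\<in>S. \<alpha> m * cnj (\<alpha> n) * char b (m - n) t)" for t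
  proof -
    have "char b (m - n) t = char b m t * cnj (char b n t)" for m n
      by (simp add: cnj_char char_mult)
    then show ?thesis
      unfolding complex_norm_square by (simp add: sum_product mult_ac)
  qed
  have int: "integrable (period_space b) (\<lambda>t. \<Sum>m\<in>S. \<Sum>n\<in>S. \<alpha> m * cnj (\<alpha> n) * char b (m - n) t)"
    by (intro Bochner_Integration.integrable_sum integrable_mult_right integrable_char)
  show "integrable (period_space b) (\<lambda>t. (norm (\<Sum>m\<in>S. \<alpha> m * char b m t))\<^sup>2)"
    using integrable_Re[OF int] by (simp only: expand[symmetric] Re_complex_of_real)
  have "of_real (LINT t|period_space b. (norm (\<Sum>m\<in>S. \<alpha> m * char b m t))\<^sup>2) =
      (LINT t|period_space b. (\<Sum>m\<in>S. \<Sum>n\<in>S. \<alpha> m * cnj (\<alpha> n) * char b (m - n) t))"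
    by (simp only: expand[symmetric] integral_complex_of_real)
  also have "\<dots> = (\<Sum>m\<in>S. \<Sum>n\<in>S. \<alpha> m * cnj (\<alpha> n) * (if m = n then of_real (1 / b) else 0))"
    by (simp add: Bochner_Integration.integral_sum integrable_char integral_char[OF \<open>b > 0\<close>])
  also have "\<dots> = (\<Sum>m\<in>S. \<alpha> m * cnj (\<alpha> m) * of_real (1 / b))"
    using \<open>finite S\<close> by (simp add: if_distrib sum.delta cong: if_cong)
  also have "\<dots> = of_real ((\<Sum>m\<in>S. (norm (\<alpha> m))\<^sup>2) / b)"
    by (simp add: complex_norm_square sum_divide_distrib del: of_real_power)
  finally show "(LINT t|period_space b. (norm (\<Sum>m\<in>S. \<alpha> m * char b m t))\<^sup>2) = (\<Sum>m\<in>S. (norm (\<alpha> m))\<^sup>2) / b"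
    by (simp only: of_real_eq_iff)
qed

text \<open>Integration is against \<open>char b m\<close> and not its conjugate, hence the index
  \<open>- m\<close>.\<close>

lemma integral_mult_sum_char:
  assumes "integrable (period_space b) F"
  shows "(LINT t|period_space b. F t * (\<Sum>m\<in>S. \<alpha> m * char b m t)) = (\<Sum>m\<in>S. \<alpha> m * fourier_coeff b F (- m))"
    and "integrable (period_space b) (\<lambda>t. F t * (\<Sum>m\<in>S. \<alpha> m * char b m t))"
proof -
  have eq: "F t * (\<Sum>m\<in>S. \<alpha> m * char b m t) = (\<Sum>m\<in>S. \<alpha> m * (F t * char b m t))" for t
    by (simp add: sum_distrib_left mult_ac)
  show "(LINT t|period_space b. F t * (\<Sum>m\<in>S. \<alpha> m * char b m t)) = (\<Sum>m\<in>S. \<alpha> m * fourier_coeff b F (- m))"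
    unfolding eq fourier_coeff_def
    by (simp add: Bochner_Integration.integral_sum integrable_mult_char[OF assms])
  show "integrable (period_space b) (\<lambda>t. F t * (\<Sum>m\<in>S. \<alpha> m * char b m t))"
    unfolding eq by (intro Bochner_Integration.integrable_sum integrable_mult_right integrable_mult_char assms)
qed

text \<open>With \<open>p\<close> as below, \<open>b * p\<close> is the partial Fourier sum of
  \<open>F\<close> over \<open>S\<close>. Its squared distance from \<open>F\<close> is nonnegative
  and expands to the integral of the square of \<open>norm (F t)\<close> minus
  \<open>b * s\<close>.\<close>

lemma bessel_inequality:
  assumes b: "b > 0" and F: "integrable (period_space b) F"
    and F2: "integrable (period_space b) (\<lambda>t. (norm (F t))\<^sup>2)" and "finite S"
  shows "(\<Sum>m\<in>S. (norm (fourier_coeff b F m))\<^sup>2) \<le> (LINT t|period_space b. (norm (F t))\<^sup>2) / b"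
proof -
  define \<alpha> where "\<alpha> = fourier_coeff b F"
  define p where "p t = (\<Sum>m\<in>S. \<alpha> m * char b m t)" for t
  define s where "s = (\<Sum>m\<in>S. (norm (\<alpha> m))\<^sup>2)"
  note p2 = integral_norm_sum_char[OF b \<open>finite S\<close>, of \<alpha>, folded p_def s_def]
  have cnj_p: "cnj (p t) = (\<Sum>m\<in>uminus ` S. cnj (\<alpha> (- m)) * char b m t)" for t
    by (simp add: p_def sum.reindex cnj_char)
  have int: "integrable (period_space b) (\<lambda>t. F t * cnj (p t))"
    unfolding cnj_p by (rule integral_mult_sum_char[OF F])
  have "(LINT t|period_space b. F t * cnj (p t)) = (\<Sum>m\<in>S. cnj (\<alpha> m) * \<alpha> m)"
    unfolding cnj_p by (subst integral_mult_sum_char[OF F]) (simp add: sum.reindex \<alpha>_def)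
  also have "\<dots> = of_real s"
    by (simp add: s_def complex_norm_square mult.commute del: of_real_power)
  finally have Fp: "(LINT t|period_space b. F t * cnj (p t)) = of_real s" .
  define R where "R t = Re (F t * cnj (p t))" for t
  have R_int: "integrable (period_space b) R" and R_eq: "(LINT t|period_space b. R t) = s"
    using integrable_Re[OF int] integral_Re[OF int] unfolding R_def Fp by simp_all
  have expand: "(norm (F t - of_real b * p t))\<^sup>2 =
      (norm (F t))\<^sup>2 - 2 * b * R t + b\<^sup>2 * (norm (p t))\<^sup>2" for t
    unfolding cmod_power2 R_def by (simp add: power2_eq_square algebra_simps)
  have "0 \<le> (LINT t|period_space b. (norm (F t - of_real b * p t))\<^sup>2)"
    by (rule Bochner_Integration.integral_nonneg) simp
  also have "\<dots> = (LINT t|period_space b. (norm (F t))\<^sup>2) - 2 * b * s + b\<^sup>2 * (s / b)"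
    unfolding expand using F2 p2 R_int R_eq by simp
  also have "\<dots> = (LINT t|period_space b. (norm (F t))\<^sup>2) - b * s"
    using b by (simp add: power2_eq_square)
  finally show ?thesis
    using b by (simp add: s_def \<alpha>_def field_simps)
qed

text \<open>Cauchy-Schwarz between the coefficients of \<open>p\<close> and those of
  \<open>F\<close>. The latter occur at reflected frequencies, which is harmless because
  \<open>s\<close> bounds the sum over every finite set.\<close>

lemma integral_mult_trig_poly_bound:
  assumes b: "b > 0" and F: "integrable (period_space b) F" and p: "trig_poly b p"
    and s: "\<And>S. finite S \<Longrightarrow> (\<Sum>m\<in>S. (norm (fourier_coeff b F m))\<^sup>2) \<le> s"
  shows "(norm (LINT t|period_space b. F t * p t))\<^sup>2 \<le> s * b * (LINT t|period_space b. (norm (p t))\<^sup>2)"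
proof -
  obtain S \<alpha> where S: "finite S" and p_eq: "p = (\<lambda>t. \<Sum>m\<in>S. \<alpha> m * char b m t)"
    using p by (rule trig_poly_expansion)
  have "norm (LINT t|period_space b. F t * p t) \<le> (\<Sum>m\<in>S. norm (\<alpha> m) * norm (fourier_coeff b F (- m)))"
    unfolding p_eq integral_mult_sum_char(1)[OF F] by (rule sum_norm_le) (simp add: norm_mult)
  then have "(norm (LINT t|period_space b. F t * p t))\<^sup>2 \<le>
      (\<Sum>m\<in>S. norm (\<alpha> m) * norm (fourier_coeff b F (- m)))\<^sup>2"
    by (rule power_mono) simp
  also have "\<dots> \<le> (\<Sum>m\<in>S. (norm (\<alpha> m))\<^sup>2) * (\<Sum>m\<in>S. (norm (fourier_coeff b F (- m)))\<^sup>2)"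
    by (rule Cauchy_Schwarz_ineq_sum)
  also have "(\<Sum>m\<in>S. (norm (fourier_coeff b F (- m)))\<^sup>2) = (\<Sum>m\<in>uminus ` S. (norm (fourier_coeff b F m))\<^sup>2)"
    by (simp add: sum.reindex)
  also have "(\<Sum>m\<in>S. (norm (\<alpha> m))\<^sup>2) * \<dots> \<le> (\<Sum>m\<in>S. (norm (\<alpha> m))\<^sup>2) * s"
    using S by (intro mult_left_mono s sum_nonneg) auto
  also have "(\<Sum>m\<in>S. (norm (\<alpha> m))\<^sup>2) = b * (LINT t|period_space b. (norm (p t))\<^sup>2)"
    using b S by (simp add: p_eq integral_norm_sum_char)
  finally show ?thesis
    by (simp add: mult_ac)
qed

text \<open>
  Square summable Fourier coefficients bound the functional \<open>p \<mapsto> \<integral> F p\<close> on trigonometric polynomials in the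
  \<open>L\<^sup>2\<close> norm; by bounded approximation this extends to the truncation \<open>\<phi>\<close> of \<open>cnj F\<close>.
\<close>

lemma integral_truncation_le:
  fixes K :: real
  assumes b: "b > 0" and F: "integrable (period_space b) F"
    and s: "\<And>S. finite S \<Longrightarrow> (\<Sum>m\<in>S. (norm (fourier_coeff b F m))\<^sup>2) \<le> s"
  defines "\<phi> \<equiv> \<lambda>t. if norm (F t) \<le> K then cnj (F t) else 0"
  shows "integrable (period_space b) (\<lambda>t. (norm (\<phi> t))\<^sup>2)"
    and "(LINT t|period_space b. (norm (\<phi> t))\<^sup>2) / b \<le> s"
proof -
  have [measurable]: "F \<in> borel_measurable (period_space b)"
    using F by simp
  have [measurable]: "\<phi> \<in> borel_measurable (period_space b)"
    unfolding \<phi>_def by measurable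
  interpret finite_measure "period_space b"
    by (rule finite_measure_period_space)
  \<comment> \<open>If \<open>K\<close> is negative then \<open>\<phi>\<close> is 0, so the absolute
    value covers all cases.\<close>
  have bound: "norm (\<phi> t) \<le> \<bar>K\<bar>" for t
    by (auto simp: \<phi>_def)
  obtain p where p: "\<And>n::nat. trig_poly b (p n)"
    and p_bound: "\<And>n t. t \<in> {0..<1 / b} \<Longrightarrow> norm (p n t) \<le> \<bar>K\<bar> + 1"
    and lim: "AE t in period_space b. (\<lambda>n. p n t) \<longlonglongrightarrow> \<phi> t"
    using trig_poly_bounded_approx[OF b, of \<phi> "\<bar>K\<bar>"] bound by auto
  have [measurable]: "p n \<in> borel_measurable (period_space b)" for n
    using p[of n] by (rule trig_poly_expansion) simp
  show "integrable (period_space b) (\<lambda>t. (norm (\<phi> t))\<^sup>2)"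
    using power_mono[OF bound norm_ge_zero, of _ 2]
    by (intro integrable_const_bound[of _ "K\<^sup>2"] AE_I2) auto
  define I where "I = (LINT t|period_space b. (norm (\<phi> t))\<^sup>2)"
  \<comment> \<open>\<open>F\<close> is only integrable, so the convergence relies on the uniform
    bound for \<open>p n\<close>.\<close>
  have "(\<lambda>n. LINT t|period_space b. F t * p n t) \<longlonglongrightarrow> (LINT t|period_space b. F t * \<phi> t)"
  proof (rule integral_dominated_convergence[where w = "\<lambda>t. (\<bar>K\<bar> + 1) * norm (F t)"])
    show "AE t in period_space b. (\<lambda>n. F t * p n t) \<longlonglongrightarrow> F t * \<phi> t"
      using lim by eventually_elim (intro tendsto_intros)
    show "AE t in period_space b. norm (F t * p n t) \<le> (\<bar>K\<bar> + 1) * norm (F t)" for n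
      using p_bound[of _ n] by (intro AE_I2) (simp add: norm_mult mult.commute mult_left_mono)
  qed (use F in auto)
  moreover have "(\<lambda>n. LINT t|period_space b. (norm (p n t))\<^sup>2) \<longlonglongrightarrow> I"
    unfolding I_def
  proof (rule integral_dominated_convergence[where w = "\<lambda>t. (\<bar>K\<bar> + 1)\<^sup>2"])
    show "AE t in period_space b. (\<lambda>n. (norm (p n t))\<^sup>2) \<longlonglongrightarrow> (norm (\<phi> t))\<^sup>2"
      using lim by eventually_elim (intro tendsto_intros)
    show "AE t in period_space b. norm ((norm (p n t))\<^sup>2) \<le> (\<bar>K\<bar> + 1)\<^sup>2" for n
      using p_bound[of _ n] by (intro AE_I2) (simp add: power_mono)
  qed auto
  ultimately have "(\<lambda>n. (norm (LINT t|period_space b. F t * p n t))\<^sup>2)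
        \<longlonglongrightarrow> (norm (LINT t|period_space b. F t * \<phi> t))\<^sup>2"
      and "(\<lambda>n. s * b * (LINT t|period_space b. (norm (p n t))\<^sup>2)) \<longlonglongrightarrow> s * b * I"
    by (auto intro: tendsto_power tendsto_norm tendsto_mult_left)
  then have "(norm (LINT t|period_space b. F t * \<phi> t))\<^sup>2 \<le> s * b * I"
    by (rule LIMSEQ_le) (use integral_mult_trig_poly_bound[OF b F p s] in auto)
  \<comment> \<open>Because \<open>\<phi>\<close> truncates the conjugate of \<open>F\<close>, the
    functional evaluated at \<open>\<phi>\<close> is \<open>I\<close> itself, and the bound becomes
    the self-referential inequality \<open>sq\<close>.\<close>
  moreover have "F t * \<phi> t = of_real ((norm (\<phi> t))\<^sup>2)" for t
    by (simp add: \<phi>_def complex_norm_square del: of_real_power)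
  ultimately have sq: "I\<^sup>2 \<le> s * b * I"
    by (simp only: integral_complex_of_real I_def[symmetric] norm_of_real power2_abs)
  show "(LINT t|period_space b. (norm (\<phi> t))\<^sup>2) / b \<le> s"
  \<comment> \<open>Cancelling a factor \<open>I\<close> requires \<open>I > 0\<close>; for
    \<open>I = 0\<close> the claim is \<open>0 \<le> s\<close>, the hypothesis for the empty
    set.\<close>
  proof (cases "I = 0")
    case True
    then show ?thesis
      using s[of "{}"] by (simp add: I_def[symmetric])
  next
    case False
    moreover have "I \<ge> 0"
      unfolding I_def by (rule Bochner_Integration.integral_nonneg) simp
    ultimately have "I > 0"
      by simp
    with sq have "I \<le> s * b"
      unfolding power2_eq_square by (rule mult_right_le_imp_le)
    then show ?thesis
      using b unfolding I_def[symmetric] by (simp add: pos_divide_le_eq)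
  qed
qed

text \<open>One direction is Bessel's inequality, trivial when the integral is infinite. For the
  other, a finite coefficient sum \<open>s\<close> bounds the integral for every truncation of
  \<open>F\<close>, and monotone convergence in the truncation level recovers
  \<open>F\<close>.\<close>

theorem parseval:
  assumes b: "b > 0" and F: "integrable (period_space b) F"
  shows "(\<Sum>\<^sub>\<infinity>m. ennreal ((norm (fourier_coeff b F m))\<^sup>2)) =
    ennreal (1 / b) * (\<integral>\<^sup>+t. ennreal ((norm (F t))\<^sup>2) \<partial>period_space b)" (is "?L = ?R")
proof (rule antisym)
  have [measurable]: "F \<in> borel_measurable (period_space b)"
    using F by simp
  have L: "?L = (SUP S\<in>{S. finite S}. ennreal (\<Sum>m\<in>S. (norm (fourier_coeff b F m))\<^sup>2))"
    by (subst nonneg_infsum_complete) (simp_all add: sum_ennreal)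
  show "?L \<le> ?R"
  proof (cases "(\<integral>\<^sup>+t. ennreal ((norm (F t))\<^sup>2) \<partial>period_space b) = \<infinity>")
    case True
    then show ?thesis
      using b by (simp add: ennreal_mult_top)
  next
    case False
    then have F2: "integrable (period_space b) (\<lambda>t. (norm (F t))\<^sup>2)"
      by (intro integrableI_bounded) (auto simp: less_top)
    have "?R = ennreal ((LINT t|period_space b. (norm (F t))\<^sup>2) / b)"
      using b F2 by (simp add: nn_integral_eq_integral ennreal_mult[symmetric])
    then show ?thesis
      unfolding L using bessel_inequality[OF b F F2] by (auto intro!: SUP_least ennreal_leI)
  qed
  show "?R \<le> ?L"
  proof (cases "?L = \<infinity>")
    case False
    define s where "s = enn2real ?L"
    have s_eq: "?L = ennreal s"
      using False unfolding s_def by (intro ennreal_enn2real[symmetric]) (simp add: less_top)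
    have s: "(\<Sum>m\<in>S. (norm (fourier_coeff b F m))\<^sup>2) \<le> s" if "finite S" for S
    proof -
      have "ennreal (\<Sum>m\<in>S. (norm (fourier_coeff b F m))\<^sup>2) \<le> ?L"
        unfolding L using that by (intro SUP_upper) auto
      then show ?thesis
        unfolding s_eq by (subst (asm) ennreal_le_iff) (auto simp: s_def)
    qed
    define \<phi> where "\<phi> k t = (if norm (F t) \<le> real k then cnj (F t) else 0)" for k t
    have [measurable]: "\<phi> k \<in> borel_measurable (period_space b)" for k
      unfolding \<phi>_def by measurable
    have "?R \<le> ennreal (1 / b) * (\<integral>\<^sup>+t. (SUP k. ennreal ((norm (\<phi> k t))\<^sup>2)) \<partial>period_space b)"
    proof (intro mult_left_mono nn_integral_mono)
      fix t
      obtain k :: nat where "norm (F t) \<le> real k"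
        using real_arch_simple by blast
      then show "ennreal ((norm (F t))\<^sup>2) \<le> (SUP k. ennreal ((norm (\<phi> k t))\<^sup>2))"
        by (intro SUP_upper2[of k]) (auto simp: \<phi>_def)
    qed simp
    also have "\<dots> = (SUP k. ennreal (1 / b) * (\<integral>\<^sup>+t. ennreal ((norm (\<phi> k t))\<^sup>2) \<partial>period_space b))"
      by (subst nn_integral_monotone_convergence_SUP)
        (auto simp: SUP_mult_left_ennreal incseq_def le_fun_def \<phi>_def intro!: ennreal_leI)
    also have "\<dots> \<le> ennreal s"
    proof (rule SUP_least)
      fix k
      show "ennreal (1 / b) * (\<integral>\<^sup>+t. ennreal ((norm (\<phi> k t))\<^sup>2) \<partial>period_space b) \<le> ennreal s"
        using integral_truncation_le[OF b F s, of "real k", folded \<phi>_def] b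
        by (simp add: nn_integral_eq_integral ennreal_mult[symmetric] ennreal_leI)
    qed
    finally show ?thesis
      by (simp add: s_eq)
  qed simp
qed

subsection \<open>Periodization\<close>

lemma infsum_ennreal_eq_nn_integral:
  fixes f :: "'a::countable \<Rightarrow> ennreal"
  assumes "infinite (UNIV :: 'a set)"
  shows "(\<Sum>\<^sub>\<infinity>x. f x) = (\<integral>\<^sup>+x. f x \<partial>count_space UNIV)"
proof -
  obtain e :: "nat \<Rightarrow> 'a" where e: "bij_betw e UNIV UNIV"
    using bij_betw_from_nat_into[OF _ assms] by auto
  have "(\<Sum>\<^sub>\<infinity>x. f x) = (\<Sum>\<^sub>\<infinity>k. f (e k))"
    by (rule infsum_reindex_bij_betw[OF e, symmetric])
  also have "\<dots> = (\<Sum>k. f (e k))"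
    by (intro sums_unique has_sum_imp_sums has_sum_infsum nonneg_summable_on_complete) simp
  also have "\<dots> = (\<integral>\<^sup>+x. f x \<partial>count_space UNIV)"
    by (simp add: nn_integral_count_space_nat[symmetric] nn_integral_bij_count_space[OF e])
  finally show ?thesis .
qed

lemma infsum_ennreal_int:
  "(\<Sum>\<^sub>\<infinity>n::int. f n) = (\<integral>\<^sup>+n. (f n :: ennreal) \<partial>count_space UNIV)"
  by (rule infsum_ennreal_eq_nn_integral) simp

text \<open>Tonelli for counting measure. The modulation index is summed inside, so that for each
  fixed translate the inner sum is a Parseval sum.\<close>

lemma infsum_ennreal_int_int:
  fixes f :: "int \<times> int \<Rightarrow> ennreal"
  shows "(\<Sum>\<^sub>\<infinity>k. f k) = (\<integral>\<^sup>+n. (\<Sum>\<^sub>\<infinity>m. f (m, n)) \<partial>count_space UNIV)"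
proof -
  interpret sigma_finite_measure "count_space (UNIV :: int set)"
    by (rule sigma_finite_measure_count_space)
  have "(\<Sum>\<^sub>\<infinity>k. f k) = (\<integral>\<^sup>+k. f k \<partial>(count_space UNIV \<Otimes>\<^sub>M count_space UNIV))"
    by (simp add: infsum_ennreal_eq_nn_integral finite_prod nn_integral_count_space_prod_eq)
  also have "\<dots> = (\<integral>\<^sup>+m. \<integral>\<^sup>+n. f (m, n) \<partial>count_space UNIV \<partial>count_space UNIV)"
    by (rule nn_integral_fst[symmetric]) (simp add: measurable_pair_measure_countable1)
  also have "\<dots> = (\<integral>\<^sup>+n. \<integral>\<^sup>+m. f (m, n) \<partial>count_space UNIV \<partial>count_space UNIV)"
    by (rule nn_integral_count_space_nn_integral) simp_all
  finally show ?thesis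
    by (simp add: infsum_ennreal_int)
qed

text \<open>Complex summability is absolute summability, and \<open>infsum\<close> defaults to 0
  without it. The right-hand side uses only countable series and a measurable condition, so
  measurability in a parameter can be read off.\<close>

lemma infsum_int_eq_suminf:
  fixes u :: "int \<Rightarrow> complex"
  shows "(\<Sum>\<^sub>\<infinity>n. u n) =
    (if (\<Sum>k. ennreal (norm (u (int_decode k)))) \<noteq> \<infinity> then \<Sum>k. u (int_decode k) else 0)"
proof (cases "(\<Sum>k. ennreal (norm (u (int_decode k)))) = \<infinity>")
  case False
  then have "summable (\<lambda>k. norm (u (int_decode k)))"
    by (intro summable_suminf_not_top) auto
  then have "(\<Sum>\<^sub>\<infinity>k. u (int_decode k)) = (\<Sum>k. u (int_decode k))"
    by (intro infsumI norm_summable_imp_has_sum summable_sums) (auto dest: summable_norm_cancel)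
  with False show ?thesis
    by (simp add: infsum_reindex_bij_betw[OF bij_int_decode])
next
  case True
  have "\<not> u summable_on UNIV"
  proof
    assume "u summable_on UNIV"
    then have "(\<lambda>n. norm (u n)) summable_on UNIV"
      by (simp add: summable_on_iff_abs_summable_on_complex)
    then have "(\<lambda>k. norm (u (int_decode k))) summable_on UNIV"
      using summable_on_reindex_bij_betw[OF bij_int_decode, of "\<lambda>n. norm (u n)"] by simp
    then have "summable (\<lambda>k. norm (u (int_decode k)))"
      by (rule summable_on_imp_summable)
    with True show False
      by (simp add: ennreal_suminf_neq_top)
  qed
  with True show ?thesis
    by (simp add: infsum_not_exists)
qed

lemma borel_measurable_infsum_int:
  fixes u :: "int \<Rightarrow> 'a \<Rightarrow> complex"
  assumes [measurable]: "\<And>n. u n \<in> borel_measurable M"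
  shows "(\<lambda>x. \<Sum>\<^sub>\<infinity>n. u n x) \<in> borel_measurable M"
  unfolding infsum_int_eq_suminf by measurable

text \<open>The sum of the norms has a finite integral, so it is finite a.e., and there the
  unordered sum agrees with the series along \<open>int_decode\<close>. The result stays a series,
  so that two such identities can be compared term by term.\<close>

lemma integral_infsum_int:
  fixes u :: "int \<Rightarrow> 'a \<Rightarrow> complex"
  assumes int: "\<And>n. integrable M (u n)"
    and fin: "(\<integral>\<^sup>+n. \<integral>\<^sup>+x. norm (u n x) \<partial>M \<partial>count_space UNIV) \<noteq> \<infinity>"
  shows "integrable M (\<lambda>x. \<Sum>\<^sub>\<infinity>n. u n x)"
    and "(LINT x|M. (\<Sum>\<^sub>\<infinity>n. u n x)) = (\<Sum>k. LINT x|M. u (int_decode k) x)"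
proof -
  have [measurable]: "u n \<in> borel_measurable M" for n
    using int by simp
  let ?v = "\<lambda>k. u (int_decode k)"
  have "(\<integral>\<^sup>+n. \<integral>\<^sup>+x. norm (u n x) \<partial>M \<partial>count_space UNIV) = (\<Sum>k. \<integral>\<^sup>+x. norm (?v k x) \<partial>M)"
    by (subst nn_integral_bij_count_space[OF bij_int_decode, symmetric]) (simp add: nn_integral_count_space_nat)
  with fin have fin': "(\<Sum>k. \<integral>\<^sup>+x. norm (?v k x) \<partial>M) \<noteq> \<infinity>"
    by simp
  have "(\<integral>\<^sup>+x. (\<Sum>k. ennreal (norm (?v k x))) \<partial>M) \<noteq> \<infinity>"
    using fin' by (subst nn_integral_suminf) auto
  then have AE_fin: "AE x in M. (\<Sum>k. ennreal (norm (?v k x))) \<noteq> \<infinity>"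
    by (intro nn_integral_noteq_infinite) auto
  have summable: "AE x in M. summable (\<lambda>k. norm (?v k x))"
    using AE_fin by eventually_elim (intro summable_suminf_not_top, auto)
  have "(\<Sum>k. ennreal (LINT x|M. norm (?v k x))) \<noteq> \<infinity>"
    using fin' int by (simp add: nn_integral_eq_integral)
  then have sums: "summable (\<lambda>k. LINT x|M. norm (?v k x))"
    by (intro summable_suminf_not_top) auto
  have eq: "AE x in M. (\<Sum>k. ?v k x) = (\<Sum>\<^sub>\<infinity>n. u n x)"
    using AE_fin by eventually_elim (simp add: infsum_int_eq_suminf)
  note [measurable] = borel_measurable_infsum_int[of u M]
  show "integrable M (\<lambda>x. \<Sum>\<^sub>\<infinity>n. u n x)"
    using integrable_cong_AE[OF _ _ eq] integrable_suminf[OF int summable sums] by simp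
  show "(LINT x|M. (\<Sum>\<^sub>\<infinity>n. u n x)) = (\<Sum>k. LINT x|M. ?v k x)"
    using integral_suminf[OF int summable sums] integral_cong_AE[OF _ _ eq] by simp
qed

section \<open>Unfolding an integral over the line onto one period\<close>

lemma measurable_lebesgue_shift [measurable]: "(\<lambda>x::real. x - k) \<in> lebesgue \<rightarrow>\<^sub>M lebesgue"
  using lebesgue_affine_measurable[of "\<lambda>_. 1" "- k"] by simp

text \<open>The translates of the half-open period tile the line; a sum over cells thus has a single
  nonzero term at each point.\<close>

lemma mem_cell_iff:
  assumes "b > (0::real)"
  shows "x + of_int n * (1 / b) \<in> {0..<1 / b} \<longleftrightarrow> n = - \<lfloor>b * x\<rfloor>"
proof -
  have "x + of_int n * (1 / b) \<in> {0..<1 / b} \<longleftrightarrow> of_int (- n) \<le> b * x \<and> b * x < of_int (- n) + 1"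
  proof -
    have "x + of_int n * (1 / b) = (b * x + of_int n) / b"
      using assms by (simp add: field_simps)
    then show ?thesis
      using assms by (auto simp: zero_le_divide_iff divide_less_cancel)
  qed
  also have "\<dots> \<longleftrightarrow> \<lfloor>b * x\<rfloor> = - n"
    by (simp only: floor_eq_iff)
  also have "\<dots> \<longleftrightarrow> n = - \<lfloor>b * x\<rfloor>"
    by linarith
  finally show ?thesis .
qed

text \<open>The function is cut along the tiling, each piece is shifted into the first period, and
  Tonelli exchanges sum and integral.\<close>

lemma nn_integral_periodization:
  assumes b: "b > 0" and [measurable]: "u \<in> borel_measurable lebesgue"
  shows "(\<integral>\<^sup>+x. u x \<partial>lebesgue) =
    (\<integral>\<^sup>+t. \<integral>\<^sup>+n. u (t - of_int n * (1 / b)) \<partial>count_space UNIV \<partial>period_space b)"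
proof -
  let ?cell = "\<lambda>n::int. \<lambda>x. indicator {0..<1 / b} (x + of_int n * (1 / b)) :: ennreal"
  have [measurable]: "(\<lambda>x::real. x + k) \<in> lebesgue \<rightarrow>\<^sub>M lebesgue" for k
    using measurable_lebesgue_shift[of "- k"] by simp
  have [measurable]: "?cell n \<in> borel_measurable lebesgue" for n
    using measurable_compose[OF measurable_lebesgue_shift[of "- (of_int n * (1 / b))"]
        borel_measurable_indicator[of "{0..<1 / b}" lebesgue]] by simp
  have cell_int: "(\<integral>\<^sup>+x. u x * ?cell n x \<partial>lebesgue) =
      (\<integral>\<^sup>+t. u (t - of_int n * (1 / b)) \<partial>period_space b)" for n
  proof -
    have "(\<lambda>x. u x * ?cell n x) \<in> borel_measurable lebesgue"
      by measurable
    from nn_integral_real_affine_lebesgue[OF this, of 1 "- (of_int n * (1 / b))"] show ?thesis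
      by (simp add: nn_integral_restrict_space)
  qed
  have "(\<integral>\<^sup>+n. u x * ?cell n x \<partial>count_space UNIV) = u x" for x
  proof -
    have "(\<integral>\<^sup>+n. u x * ?cell n x \<partial>count_space UNIV) =
        (\<integral>\<^sup>+n. u x * indicator {- \<lfloor>b * x\<rfloor>} n \<partial>count_space UNIV)"
      using mem_cell_iff[OF b, of x] by (intro nn_integral_cong) (simp add: indicator_def)
    then show ?thesis
      by (simp add: nn_integral_cmult_indicator)
  qed
  then have "(\<integral>\<^sup>+x. u x \<partial>lebesgue) = (\<integral>\<^sup>+x. \<integral>\<^sup>+n. u x * ?cell n x \<partial>count_space UNIV \<partial>lebesgue)"
    by simp
  also have "\<dots> = (\<integral>\<^sup>+n. \<integral>\<^sup>+x. u x * ?cell n x \<partial>lebesgue \<partial>count_space UNIV)"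
    by (rule nn_integral_count_space_nn_integral) (simp, measurable)
  also have "\<dots> = (\<integral>\<^sup>+t. \<integral>\<^sup>+n. u (t - of_int n * (1 / b)) \<partial>count_space UNIV \<partial>period_space b)"
    unfolding cell_int
    by (rule nn_integral_count_space_nn_integral[symmetric]) (auto intro: measurable_restrict_space1)
  finally show ?thesis .
qed

text \<open>The piece \<open>w n\<close> of \<open>v\<close> on the \<open>n\<close>-th cell
  becomes, after a shift, \<open>v (t - of_int n * (1 / b))\<close> on the first period. Both
  families have total norm equal to the integral of \<open>norm (v x)\<close>, so
  \<open>integral_infsum_int\<close> applies to each and the two integrals are the same
  series.\<close>

lemma integral_periodization:
  fixes v :: "real \<Rightarrow> complex"
  assumes b: "b > 0" and v: "integrable lebesgue v"
  shows "integrable (period_space b) (\<lambda>t. \<Sum>\<^sub>\<infinity>n::int. v (t - of_int n * (1 / b)))"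
    and "(LINT t|period_space b. (\<Sum>\<^sub>\<infinity>n::int. v (t - of_int n * (1 / b)))) = (LINT x|lebesgue. v x)"
proof -
  have [measurable]: "v \<in> borel_measurable lebesgue"
    using v by simp
  define w where "w n x = indicat_real {0..<1 / b} (x + of_int n * (1 / b)) *\<^sub>R v x" for n :: int and x
  have w_eq: "w n x = (if n = - \<lfloor>b * x\<rfloor> then v x else 0)" for n x
    unfolding w_def using mem_cell_iff[OF b, of x n] by (simp add: indicator_def)
  have shift: "w n (- (of_int n * (1 / b)) + 1 * t) = indicat_real {0..<1 / b} t *\<^sub>R v (t - of_int n * (1 / b))" for n t
    by (simp add: w_def)
  have [measurable]: "(\<lambda>x::real. x + k) \<in> lebesgue \<rightarrow>\<^sub>M lebesgue" for k
    using measurable_lebesgue_shift[of "- k"] by simp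
  have [measurable]: "(\<lambda>x. indicat_real {0..<1 / b} (x + of_int n * (1 / b))) \<in> borel_measurable lebesgue" for n :: int
    using measurable_compose[OF measurable_lebesgue_shift[of "- (of_int n * (1 / b))"]
        borel_measurable_indicator[of "{0..<1 / b}" lebesgue]] by simp
  have w_int: "integrable lebesgue (w n)" for n
  proof (rule Bochner_Integration.integrable_bound[OF v])
    show "w n \<in> borel_measurable lebesgue"
      unfolding w_def by measurable
  qed (simp add: w_eq)
  have int: "integrable (period_space b) (\<lambda>t. v (t - of_int n * (1 / b)))" for n :: int
    using lebesgue_integrable_real_affine[OF w_int, of 1 n "- (of_int n * (1 / b))"]
    unfolding shift by (simp add: integrable_restrict_space)
  have int_eq: "(LINT t|period_space b. v (t - of_int n * (1 / b))) = (LINT x|lebesgue. w n x)" for n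
    using lebesgue_integral_real_affine[of 1 "w n" "- (of_int n * (1 / b))"]
    unfolding shift by (simp add: integral_restrict_space)
  have fin: "(\<integral>\<^sup>+x. norm (v x) \<partial>lebesgue) \<noteq> \<infinity>"
    using v by (simp add: integrable_iff_bounded)
  have "(\<integral>\<^sup>+n. \<integral>\<^sup>+t. norm (v (t - of_int n * (1 / b))) \<partial>period_space b \<partial>count_space (UNIV :: int set)) =
      (\<integral>\<^sup>+x. norm (v x) \<partial>lebesgue)"
    using int by (subst nn_integral_periodization[OF b])
      (auto intro!: nn_integral_count_space_nn_integral[symmetric])
  with fin have 1: "(\<integral>\<^sup>+n. \<integral>\<^sup>+t. norm (v (t - of_int n * (1 / b))) \<partial>period_space b \<partial>count_space (UNIV :: int set)) \<noteq> \<infinity>"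
    by simp
  have "(\<integral>\<^sup>+n. norm (w n x) \<partial>count_space UNIV) = norm (v x)" for x
  proof -
    have "(\<integral>\<^sup>+n. norm (w n x) \<partial>count_space UNIV) =
        (\<integral>\<^sup>+n. norm (v x) * indicator {- \<lfloor>b * x\<rfloor>} n \<partial>count_space UNIV)"
      by (intro nn_integral_cong) (simp add: w_eq indicator_def)
    then show ?thesis
      by (simp add: nn_integral_cmult_indicator)
  qed
  moreover have "(\<integral>\<^sup>+n. \<integral>\<^sup>+x. norm (w n x) \<partial>lebesgue \<partial>count_space (UNIV :: int set)) =
      (\<integral>\<^sup>+x. \<integral>\<^sup>+n. norm (w n x) \<partial>count_space UNIV \<partial>lebesgue)"
    using w_int by (intro nn_integral_count_space_nn_integral[symmetric]) auto
  ultimately have 2: "(\<integral>\<^sup>+n. \<integral>\<^sup>+x. norm (w n x) \<partial>lebesgue \<partial>count_space (UNIV :: int set)) \<noteq> \<infinity>"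
    using fin by simp
  have w_sum: "(\<Sum>\<^sub>\<infinity>n. w n x) = v x" for x
  proof -
    have "(\<Sum>\<^sub>\<infinity>n. w n x) = (\<Sum>\<^sub>\<infinity>n\<in>{- \<lfloor>b * x\<rfloor>}. w n x)"
      by (rule infsum_cong_neutral) (auto simp: w_eq)
    then show ?thesis
      by (simp add: w_eq)
  qed
  show "integrable (period_space b) (\<lambda>t. \<Sum>\<^sub>\<infinity>n::int. v (t - of_int n * (1 / b)))"
    by (rule integral_infsum_int(1)[OF int 1])
  show "(LINT t|period_space b. (\<Sum>\<^sub>\<infinity>n::int. v (t - of_int n * (1 / b)))) = (LINT x|lebesgue. v x)"
    using integral_infsum_int(2)[OF int 1] integral_infsum_int(2)[OF w_int 2]
    unfolding int_eq w_sum by simp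
qed

subsection \<open>Brackets and frame sums\<close>

lemma L2_measurable: "f \<in> L2 \<Longrightarrow> f \<in> borel_measurable lebesgue"
  by (simp add: L2_def)

lemma L2_integrable_mult_cnj:
  assumes "f \<in> L2" "h \<in> L2"
  shows "integrable lebesgue (\<lambda>x. f x * cnj (h x))"
proof (rule Bochner_Integration.integrable_bound)
  note [measurable] = assms[THEN L2_measurable]
  show "integrable lebesgue (\<lambda>x. (norm (f x))\<^sup>2 + (norm (h x))\<^sup>2)"
    using assms by (simp add: L2_def)
  show "(\<lambda>x. f x * cnj (h x)) \<in> borel_measurable lebesgue"
    by measurable
  have "y * z \<le> y\<^sup>2 + z\<^sup>2" if "0 \<le> y" "0 \<le> z" for y z :: real
    using sum_squares_bound[of y z] mult_nonneg_nonneg[OF that] by linarith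
  then show "AE x in lebesgue. norm (f x * cnj (h x)) \<le> norm ((norm (f x))\<^sup>2 + (norm (h x))\<^sup>2)"
    by (simp add: norm_mult)
qed

lemma L2_translates:
  assumes "g \<in> L2"
  shows "translates g a n \<in> L2"
proof -
  have "integrable lebesgue (\<lambda>x. (norm (g (x - of_int n * a)))\<^sup>2)"
    using assms lebesgue_integrable_real_affine[of "\<lambda>x. (norm (g x))\<^sup>2" 1 "- (of_int n * a)"] by (simp add: L2_def)
  moreover have "(\<lambda>x. g (x - of_int n * a)) \<in> borel_measurable lebesgue"
    using assms by (intro measurable_compose[OF measurable_lebesgue_shift]) (simp add: L2_def)
  ultimately show ?thesis
    by (simp add: L2_def translates_def translation_def)
qed

lemma L2_restrict:
  assumes "f \<in> L2" and [measurable]: "E \<in> sets lebesgue"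
  shows "(\<lambda>x. if x \<in> E then f x else 0) \<in> L2"
proof -
  note [measurable] = assms(1)[THEN L2_measurable]
  have meas: "(\<lambda>x. if x \<in> E then f x else 0) \<in> borel_measurable lebesgue"
    by measurable
  moreover have "integrable lebesgue (\<lambda>x. (norm (if x \<in> E then f x else 0))\<^sup>2)"
    by (rule Bochner_Integration.integrable_bound[where f = "\<lambda>x. (norm (f x))\<^sup>2"])
      (use assms meas in \<open>auto simp: L2_def\<close>)
  ultimately show ?thesis
    by (simp add: L2_def)
qed

lemma bracket_measurable:
  assumes "f \<in> L2" "h \<in> L2"
  shows "bracket c f h \<in> borel_measurable lebesgue"
proof -
  note [measurable] = assms[THEN L2_measurable]
  have [measurable]: "(\<lambda>x. f (x - k)) \<in> borel_measurable lebesgue" "(\<lambda>x. h (x - k)) \<in> borel_measurable lebesgue" for k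
    by (rule measurable_compose[OF measurable_lebesgue_shift], measurable)+
  have "(\<lambda>t. \<Sum>\<^sub>\<infinity>n::int. f (t - of_int n * c) * cnj (h (t - of_int n * c))) \<in> borel_measurable lebesgue"
    by (rule borel_measurable_infsum_int) measurable
  then show ?thesis
    by (simp add: bracket_def[abs_def])
qed

lemma bracket_periodic: "bracket c f h (t - of_int k * c) = bracket c f h t"
proof -
  have "bij_betw (\<lambda>n. k + n) UNIV (UNIV :: int set)"
    by (rule bij_betw_byWitness[where f' = "\<lambda>n. n - k"]) auto
  then show ?thesis
    unfolding bracket_def
    by (subst infsum_reindex_bij_betw[symmetric]) (auto simp: algebra_simps intro!: infsum_cong)
qed

text \<open>All points \<open>t - of_int n * c\<close> lie in \<open>E\<close> or none does, so the
  cutoff is a constant factor of the sum.\<close>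

lemma bracket_restrict:
  assumes "\<And>n::int. t - of_int n * c \<in> E \<longleftrightarrow> t \<in> E"
  shows "bracket c (\<lambda>x. if x \<in> E then f x else 0) h t = (if t \<in> E then bracket c f h t else 0)"
    and "bracket c (\<lambda>x. if x \<in> E then f x else 0) (\<lambda>x. if x \<in> E then f x else 0) t =
      (if t \<in> E then bracket c f f t else 0)"
  using assms by (simp_all add: bracket_def)

lemma bracket_self_nonneg: "Re (bracket c f f t) \<ge> 0"
proof (cases "(\<lambda>n::int. f (t - of_int n * c) * cnj (f (t - of_int n * c))) summable_on UNIV")
  case True
  then show ?thesis
    unfolding bracket_def infsum_Re[OF True, symmetric]
    by (intro infsum_nonneg) (simp add: complex_mult_cnj)
next
  case False
  then show ?thesis
    by (simp add: bracket_def infsum_not_exists)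
qed

lemma bracket_norm_power2: "(bracket_norm c f t)\<^sup>2 = Re (bracket c f f t)"
  by (simp add: bracket_norm_def bracket_self_nonneg)

lemma integrable_bracket:
  assumes "b > 0" "f \<in> L2" "h \<in> L2"
  shows "integrable (period_space b) (bracket (1 / b) f h)"
  using integral_periodization(1)[OF assms(1) L2_integrable_mult_cnj[OF assms(2,3)]]
  by (simp add: bracket_def[abs_def])

text \<open>The periodization of \<open>f x * cnj (f x)\<close> is the bracket of \<open>f\<close>
  with itself.\<close>

lemma L2_norm_eq_bracket_norm:
  assumes "b > 0" "f \<in> L2"
  shows "ennreal ((L2_norm f)\<^sup>2) = (\<integral>\<^sup>+t. ennreal ((bracket_norm (1 / b) f t)\<^sup>2) \<partial>period_space b)"
proof -
  note int = integrable_bracket[OF assms assms(2)]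
  have "of_real ((L2_norm f)\<^sup>2) = (LINT x|lebesgue. complex_of_real ((norm (f x))\<^sup>2))"
    unfolding integral_complex_of_real by (simp add: L2_norm_def)
  also have "\<dots> = (LINT x|lebesgue. f x * cnj (f x))"
    by (simp only: complex_norm_square)
  also have "\<dots> = (LINT t|period_space b. bracket (1 / b) f f t)"
    unfolding bracket_def
    by (rule integral_periodization(2)[OF assms(1) L2_integrable_mult_cnj[OF assms(2,2)], symmetric])
  finally have "(L2_norm f)\<^sup>2 = Re (LINT t|period_space b. bracket (1 / b) f f t)"
    using Re_complex_of_real[of "(L2_norm f)\<^sup>2"] by simp
  also have "\<dots> = (LINT t|period_space b. Re (bracket (1 / b) f f t))"
    by (rule integral_Re[OF int, symmetric])
  finally show ?thesis
    unfolding bracket_norm_power2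
    by (subst nn_integral_eq_integral) (auto intro: integrable_Re int simp: bracket_self_nonneg)
qed

text \<open>The character has period \<open>1 / b\<close>, so it is constant along the points of the
  bracket sum and factors out of it. Conjugation in the second argument produces the frequency
  \<open>- m\<close> of \<open>fourier_coeff\<close>.\<close>

lemma L2_inner_modulation:
  assumes b: "b > 0" and fh: "f \<in> L2" "h \<in> L2"
  shows "L2_inner f (modulation (of_int m * b) h) = fourier_coeff b (bracket (1 / b) f h) m"
proof -
  let ?v = "\<lambda>x. f x * cnj (h x) * char b (- m) x"
  note int = L2_integrable_mult_cnj[OF fh]
  have "(\<lambda>x. f x * cnj (h x)) \<in> borel_measurable lebesgue"
    using int by (rule borel_measurable_integrable)
  moreover have "char b (- m) \<in> borel_measurable lebesgue"
    using measurable_char[of b "- m" UNIV] by (simp add: lebesgue_on_UNIV_eq)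
  ultimately have "?v \<in> borel_measurable lebesgue"
    by (rule borel_measurable_times)
  then have v: "integrable lebesgue ?v"
    by (rule Bochner_Integration.integrable_bound[OF int]) (simp add: norm_mult)
  have "L2_inner f (modulation (of_int m * b) h) = (LINT x|lebesgue. ?v x)"
    unfolding L2_inner_def modulation_eq_char by (simp add: cnj_char mult_ac)
  also have "\<dots> = (LINT t|period_space b. (\<Sum>\<^sub>\<infinity>n::int. ?v (t - of_int n * (1 / b))))"
    by (rule integral_periodization(2)[OF b v, symmetric])
  also have "\<dots> = fourier_coeff b (bracket (1 / b) f h) m"
    unfolding fourier_coeff_def bracket_def char_periodic[OF less_imp_neq[OF b, symmetric]]
    by (simp only: infsum_cmult_left')
  finally show ?thesis .
qed

text \<open>Parseval for each translate sums out the modulations; Tonelli then moves the sum over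
  translates under the integral.\<close>

lemma WH_sum_eq:
  assumes b: "b > 0" and f: "f \<in> L2" and g: "g \<in> L2"
  shows "(\<Sum>\<^sub>\<infinity>k::int \<times> int. ennreal ((norm (L2_inner f (WH_family g a b k)))\<^sup>2)) =
    ennreal (1 / b) * (\<integral>\<^sup>+t. (\<Sum>\<^sub>\<infinity>n::int. ennreal ((norm (bracket (1 / b) f (translates g a n) t))\<^sup>2)) \<partial>period_space b)"
proof -
  let ?F = "\<lambda>n. bracket (1 / b) f (translates g a n)"
  have F: "integrable (period_space b) (?F n)" for n
    by (rule integrable_bracket[OF b f L2_translates[OF g]])
  then have [measurable]: "?F n \<in> borel_measurable (period_space b)" for n
    by simp
  have "(\<Sum>\<^sub>\<infinity>k::int \<times> int. ennreal ((norm (L2_inner f (WH_family g a b k)))\<^sup>2)) =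
      (\<integral>\<^sup>+n. (\<Sum>\<^sub>\<infinity>m. ennreal ((norm (fourier_coeff b (?F n) m))\<^sup>2)) \<partial>count_space UNIV)"
    unfolding infsum_ennreal_int_int
    using L2_inner_modulation[OF b f L2_translates[OF g, unfolded translates_def]]
    by (simp add: WH_family_def translates_def)
  also have "\<dots> = (\<integral>\<^sup>+n. ennreal (1 / b) * (\<integral>\<^sup>+t. ennreal ((norm (?F n t))\<^sup>2) \<partial>period_space b) \<partial>count_space UNIV)"
    by (simp only: parseval[OF b F])
  also have "\<dots> = ennreal (1 / b) * (\<integral>\<^sup>+n. \<integral>\<^sup>+t. ennreal ((norm (?F n t))\<^sup>2) \<partial>period_space b \<partial>count_space UNIV)"
    by (rule nn_integral_cmult) simp
  also have "(\<integral>\<^sup>+n. \<integral>\<^sup>+t. ennreal ((norm (?F n t))\<^sup>2) \<partial>period_space b \<partial>count_space UNIV) =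
      (\<integral>\<^sup>+t. \<integral>\<^sup>+n. ennreal ((norm (?F n t))\<^sup>2) \<partial>count_space UNIV \<partial>period_space b)"
    by (rule nn_integral_count_space_nn_integral[symmetric]) auto
  finally show ?thesis
    by (simp only: infsum_ennreal_int)
qed

text \<open>On the set \<open>E\<close> where the claim fails, \<open>v < u\<close> pointwise while
  the integrals compare the other way. As the integral of \<open>v\<close> over \<open>E\<close> is
  finite, \<open>E\<close> is null within one period and, being periodic, null on the line.\<close>

lemma AE_periodic_le:
  fixes u v :: "real \<Rightarrow> ennreal"
  assumes b: "b > 0"
    and [measurable]: "u \<in> borel_measurable lebesgue" "v \<in> borel_measurable lebesgue"
    and periodic: "\<And>t n. u (t - of_int n * (1 / b)) = u t" "\<And>t n. v (t - of_int n * (1 / b)) = v t"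
    and le: "\<And>E. E \<in> sets lebesgue \<Longrightarrow> (\<And>t n. t - of_int n * (1 / b) \<in> E \<longleftrightarrow> t \<in> E) \<Longrightarrow>
      (\<integral>\<^sup>+t. u t * indicator E t \<partial>period_space b) \<le> (\<integral>\<^sup>+t. v t * indicator E t \<partial>period_space b)"
    and fin: "(\<integral>\<^sup>+t. u t \<partial>period_space b) \<noteq> \<infinity> \<or> (\<integral>\<^sup>+t. v t \<partial>period_space b) \<noteq> \<infinity>"
  shows "AE t in lebesgue. u t \<le> v t"
proof -
  define E where "E = {t \<in> space lebesgue. v t < u t}"
  have E [measurable]: "E \<in> sets lebesgue"
    unfolding E_def by measurable
  have E_periodic: "t - of_int n * (1 / b) \<in> E \<longleftrightarrow> t \<in> E" for t and n :: int
    by (simp add: E_def periodic[simplified])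
  have [measurable]: "(\<lambda>t. u t * indicator E t) \<in> borel_measurable (period_space b)"
      "(\<lambda>t. v t * indicator E t) \<in> borel_measurable (period_space b)"
    by (rule measurable_restrict_space1, measurable)+
  have E_le: "(\<integral>\<^sup>+t. u t * indicator E t \<partial>period_space b) \<le> (\<integral>\<^sup>+t. v t * indicator E t \<partial>period_space b)"
    using E E_periodic by (rule le)
  have vu: "v t * indicator E t \<le> u t * indicator E t" for t
    by (auto simp: E_def indicator_def)
  \<comment> \<open>Since \<open>v < u\<close> on \<open>E\<close>, the integral of \<open>v\<close>
    over \<open>E\<close> lies below both full integrals, so finiteness of either one
    suffices.\<close>
  have "(\<integral>\<^sup>+t. v t * indicator E t \<partial>period_space b) \<le> (\<integral>\<^sup>+t. v t \<partial>period_space b)"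
    by (intro nn_integral_mono) (simp add: indicator_def)
  moreover have "(\<integral>\<^sup>+t. v t * indicator E t \<partial>period_space b) \<le> (\<integral>\<^sup>+t. u t \<partial>period_space b)"
    by (intro nn_integral_mono) (auto simp: indicator_def E_def)
  ultimately have "(\<integral>\<^sup>+t. v t * indicator E t \<partial>period_space b) \<noteq> \<infinity>"
    using fin by (auto simp: top_unique)
  then have "\<not> (AE t in period_space b. u t * indicator E t \<le> v t * indicator E t) \<Longrightarrow>
      (\<integral>\<^sup>+t. v t * indicator E t \<partial>period_space b) < (\<integral>\<^sup>+t. u t * indicator E t \<partial>period_space b)"
    using vu by (intro nn_integral_less) auto
  with E_le have "AE t in period_space b. u t * indicator E t \<le> v t * indicator E t"
    by (meson leD)
  then have "AE t in period_space b. t \<notin> E"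
    by eventually_elim (auto simp: E_def indicator_def split: if_splits)
  \<comment> \<open>Unfolding the indicator of \<open>E\<close>: by periodicity every term of the
    inner sum is its value at \<open>t\<close>, which is 0 for almost every \<open>t\<close> in the
    period.\<close>
  moreover have "emeasure lebesgue E =
      (\<integral>\<^sup>+t. \<integral>\<^sup>+n. indicator E (t - of_int n * (1 / b)) \<partial>count_space (UNIV :: int set) \<partial>period_space b)"
    using nn_integral_periodization[OF b, of "indicator E"] by simp
  then have "emeasure lebesgue E = (\<integral>\<^sup>+t. \<integral>\<^sup>+n. indicator E t \<partial>count_space (UNIV :: int set) \<partial>period_space b)"
    using E_periodic by (simp add: indicator_def)
  moreover have "\<dots> = (\<integral>\<^sup>+t. 0 \<partial>period_space b)"
    using \<open>AE t in period_space b. t \<notin> E\<close> by (intro nn_integral_cong_AE) (auto elim!: eventually_mono)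
  ultimately have "E \<in> null_sets lebesgue"
    by (simp add: null_sets_def)
  then have "AE t in lebesgue. t \<notin> E"
    by (rule AE_not_in)
  then show ?thesis
    by eventually_elim (simp add: E_def not_less)
qed

lemma bracket_sum_measurable:
  assumes "f \<in> L2" "g \<in> L2"
  shows "(\<lambda>t. \<Sum>\<^sub>\<infinity>n::int. ennreal ((norm (bracket c f (translates g a n) t))\<^sup>2)) \<in> borel_measurable lebesgue"
proof -
  have [measurable]: "bracket c f (translates g a n) \<in> borel_measurable lebesgue" for n
    by (rule bracket_measurable[OF assms(1) L2_translates[OF assms(2)]])
  have eq: "(\<Sum>\<^sub>\<infinity>n::int. F n) = (\<Sum>k. F (int_decode k))" for F :: "int \<Rightarrow> ennreal"
    using nn_integral_bij_count_space[OF bij_int_decode, of F]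
    by (simp add: infsum_ennreal_int nn_integral_count_space_nat)
  show ?thesis
    unfolding eq by measurable
qed

lemma L2_norm_restrict:
  assumes b: "b > 0" and f: "f \<in> L2" and E: "E \<in> sets lebesgue"
    and E_periodic: "\<And>t n. t - of_int n * (1 / b) \<in> E \<longleftrightarrow> t \<in> E"
  shows "ennreal ((L2_norm (\<lambda>x. if x \<in> E then f x else 0))\<^sup>2) =
    (\<integral>\<^sup>+t. ennreal ((bracket_norm (1 / b) f t)\<^sup>2) * indicator E t \<partial>period_space b)"
  unfolding L2_norm_eq_bracket_norm[OF b L2_restrict[OF f E]] bracket_norm_power2
    bracket_restrict(2)[OF E_periodic]
  by (intro nn_integral_cong) (simp add: indicator_def)

lemma WH_sum_restrict:
  assumes b: "b > 0" and f: "f \<in> L2" and g: "g \<in> L2" and E: "E \<in> sets lebesgue"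
    and E_periodic: "\<And>t n. t - of_int n * (1 / b) \<in> E \<longleftrightarrow> t \<in> E"
  shows "(\<Sum>\<^sub>\<infinity>k::int \<times> int. ennreal ((norm (L2_inner (\<lambda>x. if x \<in> E then f x else 0) (WH_family g a b k)))\<^sup>2)) =
    ennreal (1 / b) * (\<integral>\<^sup>+t. (\<Sum>\<^sub>\<infinity>n::int. ennreal ((norm (bracket (1 / b) f (translates g a n) t))\<^sup>2))
      * indicator E t \<partial>period_space b)"
proof -
  have "(\<Sum>\<^sub>\<infinity>n::int. ennreal ((norm (bracket (1 / b) (\<lambda>x. if x \<in> E then f x else 0) (translates g a n) t))\<^sup>2)) =
      (\<Sum>\<^sub>\<infinity>n::int. ennreal ((norm (bracket (1 / b) f (translates g a n) t))\<^sup>2)) * indicator E t" for t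
    using bracket_restrict(1)[of t "1 / b" E f, OF E_periodic] by (cases "t \<in> E") simp_all
  then show ?thesis
    by (simp only: WH_sum_eq[OF b L2_restrict[OF f E] g])
qed

text \<open>As \<open>b\<close> is positive and finite, multiplication by \<open>b\<close> on
  \<open>ennreal\<close> is monotone with monotone inverse, multiplication by
  \<open>1 / b\<close>.\<close>

lemma ennreal_divide_le_iff:
  assumes "b > 0"
  shows "x \<le> ennreal (1 / b) * y \<longleftrightarrow> ennreal b * x \<le> y"
    and "ennreal (1 / b) * y \<le> x \<longleftrightarrow> y \<le> ennreal b * x"
proof -
  have inv: "ennreal b * (ennreal (1 / b) * z) = z" "ennreal (1 / b) * (ennreal b * z) = z" for z
    using assms by (simp_all add: mult.assoc[symmetric] ennreal_mult[symmetric])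
  have le: "v \<le> w \<Longrightarrow> u * v \<le> u * w" for u v w :: ennreal
    by (rule mult_left_mono) simp_all
  show "x \<le> ennreal (1 / b) * y \<longleftrightarrow> ennreal b * x \<le> y"
    using le[of x "ennreal (1 / b) * y" "ennreal b"] le[of "ennreal b * x" y "ennreal (1 / b)"]
    unfolding inv by blast
  show "ennreal (1 / b) * y \<le> x \<longleftrightarrow> y \<le> ennreal b * x"
    using le[of "ennreal (1 / b) * y" x "ennreal b"] le[of y "ennreal b * x" "ennreal (1 / b)"]
    unfolding inv by blast
qed

theorem corollary8p7:
  fixes g :: "real \<Rightarrow> complex" and a b :: real
  assumes "g \<in> L2" and "a > 0" and "b > 0"
  shows "c_frame (1 / b) (translates g a) \<longleftrightarrow> WH_frame g a b"
proof
  define X where "X f t = (\<Sum>\<^sub>\<infinity>n::int. ennreal ((norm (bracket (1 / b) f (translates g a n) t))\<^sup>2))" for f t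
  define Y where "Y f t = ennreal ((bracket_norm (1 / b) f t)\<^sup>2)" for f t
  have X_meas: "X f \<in> borel_measurable lebesgue" if "f \<in> L2" for f
    using bracket_sum_measurable[OF that \<open>g \<in> L2\<close>] by (simp add: X_def[abs_def])
  have Y_meas: "Y f \<in> borel_measurable lebesgue" if "f \<in> L2" for f
    using bracket_measurable[OF that that, of "1 / b"] unfolding Y_def bracket_norm_power2 by measurable
  have Y_meas': "Y f \<in> borel_measurable (period_space b)" if "f \<in> L2" for f
    using Y_meas[OF that] by (rule measurable_restrict_space1)
  have Y_int: "(\<integral>\<^sup>+t. Y f t \<partial>period_space b) = ennreal ((L2_norm f)\<^sup>2)" if "f \<in> L2" for f
    unfolding Y_def by (rule L2_norm_eq_bracket_norm[OF \<open>b > 0\<close> that, symmetric])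
  have AE_restrict: "AE t in lebesgue. P t \<Longrightarrow> AE t in period_space b. P t" for P
    by (subst AE_restrict_space_iff) (auto elim: eventually_mono)
  {
    assume "c_frame (1 / b) (translates g a)"
    then obtain A B where AB: "A > 0" "B > 0"
      and frame: "\<And>f. f \<in> L2 \<Longrightarrow> AE t in lebesgue.
        ennreal (A * (bracket_norm (1 / b) f t)\<^sup>2) \<le> X f t \<and> X f t \<le> ennreal (B * (bracket_norm (1 / b) f t)\<^sup>2)"
      unfolding c_frame_def X_def by blast
    show "WH_frame g a b"
      unfolding WH_frame_def
    \<comment> \<open>The bounds shrink by \<open>1 / b\<close>, the factor in front of the integral
      in \<open>WH_sum_eq\<close>; the converse direction multiplies by \<open>b\<close>
      instead.\<close>
    proof (rule exI[of _ "A / b"], rule exI[of _ "B / b"], intro conjI ballI)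
      fix f assume f: "f \<in> L2"
      have "AE t in lebesgue. ennreal A * Y f t \<le> X f t \<and> X f t \<le> ennreal B * Y f t"
        using frame[OF f] AB by (simp add: Y_def ennreal_mult)
      then have AE: "AE t in period_space b. ennreal A * Y f t \<le> X f t \<and> X f t \<le> ennreal B * Y f t"
        by (rule AE_restrict)
      have "ennreal (C / b * (L2_norm f)\<^sup>2) = ennreal (1 / b) * (\<integral>\<^sup>+t. ennreal C * Y f t \<partial>period_space b)"
        if "C > 0" for C
        using that \<open>b > 0\<close> Y_meas'[OF f]
        by (simp add: nn_integral_cmult Y_int[OF f] ennreal_mult[symmetric])
      note const = this[OF \<open>A > 0\<close>] this[OF \<open>B > 0\<close>]
      show "ennreal (A / b * (L2_norm f)\<^sup>2)
          \<le> (\<Sum>\<^sub>\<infinity>k::int \<times> int. ennreal ((norm (L2_inner f (WH_family g a b k)))\<^sup>2))"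
        unfolding const WH_sum_eq[OF \<open>b > 0\<close> f \<open>g \<in> L2\<close>] X_def[symmetric]
        using AE by (intro mult_left_mono nn_integral_mono_AE) (auto elim: eventually_mono)
      show "(\<Sum>\<^sub>\<infinity>k::int \<times> int. ennreal ((norm (L2_inner f (WH_family g a b k)))\<^sup>2))
          \<le> ennreal (B / b * (L2_norm f)\<^sup>2)"
        unfolding const WH_sum_eq[OF \<open>b > 0\<close> f \<open>g \<in> L2\<close>] X_def[symmetric]
        using AE by (intro mult_left_mono nn_integral_mono_AE) (auto elim: eventually_mono)
    qed (use AB \<open>b > 0\<close> in auto)
  next
    assume "WH_frame g a b"
    then obtain A B where AB: "A > 0" "B > 0"
      and frame: "\<And>f. f \<in> L2 \<Longrightarrow>
        ennreal (A * (L2_norm f)\<^sup>2) \<le> (\<Sum>\<^sub>\<infinity>k::int \<times> int. ennreal ((norm (L2_inner f (WH_family g a b k)))\<^sup>2)) \<and>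
        (\<Sum>\<^sub>\<infinity>k::int \<times> int. ennreal ((norm (L2_inner f (WH_family g a b k)))\<^sup>2)) \<le> ennreal (B * (L2_norm f)\<^sup>2)"
      unfolding WH_frame_def by blast
    have "AE t in lebesgue. ennreal (b * A) * Y f t \<le> X f t" "AE t in lebesgue. X f t \<le> ennreal (b * B) * Y f t"
      if f: "f \<in> L2" for f
    proof -
      note [measurable] = X_meas[OF f] Y_meas[OF f]
      have periodic: "X f (t - of_int n * (1 / b)) = X f t" "Y f (t - of_int n * (1 / b)) = Y f t" for t n
        unfolding X_def Y_def bracket_norm_power2 bracket_periodic by simp_all
      \<comment> \<open>The integral is \<open>C\<close> times the squared norm of \<open>f\<close>;
        this supplies the finiteness in both uses of \<open>AE_periodic_le\<close>.\<close>
      have fin: "(\<integral>\<^sup>+t. ennreal C * Y f t \<partial>period_space b) \<noteq> \<infinity>" for C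
        using Y_meas'[OF f] by (simp add: nn_integral_cmult Y_int[OF f] ennreal_mult_eq_top_iff)
      have scale: "(\<integral>\<^sup>+t. ennreal (b * C) * Y f t * indicator E t \<partial>period_space b) =
          ennreal b * ennreal (C * (L2_norm (\<lambda>x. if x \<in> E then f x else 0))\<^sup>2)"
        if "C > 0" "E \<in> sets lebesgue" "\<And>t n. t - of_int n * (1 / b) \<in> E \<longleftrightarrow> t \<in> E" for C E
      proof -
        note [measurable] = that(2)
        have "(\<lambda>t. Y f t * indicator E t) \<in> borel_measurable (period_space b)"
          by (intro measurable_restrict_space1) measurable
        then have "(\<integral>\<^sup>+t. ennreal (b * C) * Y f t * indicator E t \<partial>period_space b) =
            ennreal (b * C) * (\<integral>\<^sup>+t. Y f t * indicator E t \<partial>period_space b)"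
          by (simp add: nn_integral_cmult mult.assoc)
        then show ?thesis
          using L2_norm_restrict[OF \<open>b > 0\<close> f that(2,3)] that(1) \<open>b > 0\<close>
          by (simp add: Y_def[symmetric] ennreal_mult mult.assoc)
      qed
      show "AE t in lebesgue. ennreal (b * A) * Y f t \<le> X f t"
      proof (rule AE_periodic_le[OF \<open>b > 0\<close>])
        fix E assume E: "E \<in> sets lebesgue" "\<And>t n. t - of_int n * (1 / b) \<in> E \<longleftrightarrow> t \<in> E"
        \<comment> \<open>The lower frame bound for the cutoff of \<open>f\<close> to
          \<open>E\<close> is this inequality once the factor \<open>1 / b\<close> is moved
          across.\<close>
        show "(\<integral>\<^sup>+t. ennreal (b * A) * Y f t * indicator E t \<partial>period_space b)
            \<le> (\<integral>\<^sup>+t. X f t * indicator E t \<partial>period_space b)"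
          using frame[OF L2_restrict[OF f E(1)]]
          unfolding scale[OF \<open>A > 0\<close> E] WH_sum_restrict[OF \<open>b > 0\<close> f \<open>g \<in> L2\<close> E] X_def[symmetric]
            ennreal_divide_le_iff[OF \<open>b > 0\<close>] by blast
      qed (use fin periodic in auto)
      show "AE t in lebesgue. X f t \<le> ennreal (b * B) * Y f t"
      proof (rule AE_periodic_le[OF \<open>b > 0\<close>])
        fix E assume E: "E \<in> sets lebesgue" "\<And>t n. t - of_int n * (1 / b) \<in> E \<longleftrightarrow> t \<in> E"
        show "(\<integral>\<^sup>+t. X f t * indicator E t \<partial>period_space b)
            \<le> (\<integral>\<^sup>+t. ennreal (b * B) * Y f t * indicator E t \<partial>period_space b)"
          using frame[OF L2_restrict[OF f E(1)]]
          unfolding scale[OF \<open>B > 0\<close> E] WH_sum_restrict[OF \<open>b > 0\<close> f \<open>g \<in> L2\<close> E] X_def[symmetric]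
            ennreal_divide_le_iff[OF \<open>b > 0\<close>] by blast
      qed (use fin periodic in auto)
    qed
    then have "\<forall>f\<in>L2. AE t in lebesgue. ennreal (b * A * (bracket_norm (1 / b) f t)\<^sup>2) \<le> X f t \<and>
        X f t \<le> ennreal (b * B * (bracket_norm (1 / b) f t)\<^sup>2)"
      using AB \<open>b > 0\<close> by (auto simp: Y_def ennreal_mult)
    moreover have "translates g a n \<in> L2" for n
      by (rule L2_translates[OF \<open>g \<in> L2\<close>])
    ultimately show "c_frame (1 / b) (translates g a)"
      unfolding c_frame_def X_def using AB \<open>b > 0\<close>
      by (intro conjI allI, simp) (rule exI[of _ "b * A"], rule exI[of _ "b * B"], simp)
  }
qed

end
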